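(* Let $n\ge 1$, let $\mathfrak{C}$ be a category, and let $$X_1\xrightarrow{f_1}X_2\xrightarrow{f_2}\cdots\xrightarrow{f_{n-1}}X_n\xrightarrow{f_n}X_1$$ be a sequence of morphisms of $\mathfrak{C}$. Assume that there is a sequence of morphisms of $\mathfrak{C}$ $$Y_1\xrightarrow{\tilde f_1}Y_2\xrightarrow{\tilde f_2}\cdots\xrightarrow{\tilde f_{n-1}}Y_n\xrightarrow{\tilde f_n}Y_1,$$ where each $Y_i$ is a subobject of $X_i$ and there are morphisms $\pi_i:X_i\to Y_i$ and $\iota_i:Y_i\to X_i$ with $\pi_i\circ\iota_i=\mathrm{id}_{Y_i}$ for $i=1,\dots,n$. Suppose in addition that $$\tilde f_n\circ\cdots\circ\tilde f_2\circ\tilde f_1=\mathrm{id}_{Y_1},\quad \tilde f_1\circ\tilde f_n\circ\cdots\circ\tilde f_3\circ\tilde f_2=\mathrm{id}_{Y_2},\ \ldots,\ \tilde f_{n-1}\circ\cdots\circ\tilde f_1\circ\tilde f_n=\mathrm{id}_{Y_n}$$ (all $n$ cyclic permutations), and that $f_i=\iota_{i+1}\circ\tilde f_i\circ\pi_i$ for $i=1,\dots,n$. Then the sequence $X_1\xrightarrow{f_1}X_2\xrightarrow{f_2}\cdots\xrightarrow{f_{n-1}}X_n\xrightarrow{f_n}X_1$ is an $n$-regular cocycle in $\mathfrak{C}$.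
   Context: Indices are taken modulo $n$ (so $X_{n+1}=X_1$, $\iota_{n+1}=\iota_1$, etc.). An $n$-regular cocycle in $\mathfrak{C}$ is a sequence of composable morphisms $X_1\xrightarrow{f_1}X_2\xrightarrow{f_2}\cdots\xrightarrow{f_{n-1}}X_n\xrightarrow{f_n}X_1$ such that, for each $i$ (modulo $n$), going once around the cycle starting with $f_i$ and then applying $f_i$ again gives $f_i$, i.e. $$f_1\circ f_n\circ\cdots\circ f_2\circ f_1=f_1,\quad f_2\circ f_1\circ f_n\circ\cdots\circ f_3\circ f_2=f_2,\ \ldots,\ f_n\circ f_{n-1}\circ\cdots\circ f_1\circ f_n=f_n.$$ In general $f_i\circ f_{i-1}\circ\cdots\circ f_{i+1}\circ f_i=f_i$, where the left side is a composition of $n+1$ morphisms. *)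

theory Defs
  imports Main
begin

record ('o, 'm) category_data =
  Obj :: "'o set"
  Arr :: "'m set"
  Dom :: "'m \<Rightarrow> 'o"
  Cod :: "'m \<Rightarrow> 'o"
  Ident :: "'o \<Rightarrow> 'm"
  Comp :: "'m \<Rightarrow> 'm \<Rightarrow> 'm" (infixl "\<cdot>\<index>" 70)

definition hom :: "('o, 'm, 'z) category_data_scheme \<Rightarrow> 'o \<Rightarrow> 'o \<Rightarrow> 'm set" where
  "hom C X Y = {f \<in> Arr C. Dom C f = X \<and> Cod C f = Y}"

text \<open>Outside composable pairs the value of \<open>Comp\<close> is unconstrained.\<close>

locale category =
  fixes C :: "('o, 'm, 'z) category_data_scheme" (structure)
  assumes dom_obj: "f \<in> Arr C \<Longrightarrow> Dom C f \<in> Obj C"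
    and cod_obj: "f \<in> Arr C \<Longrightarrow> Cod C f \<in> Obj C"
    and id_hom: "X \<in> Obj C \<Longrightarrow> Ident C X \<in> hom C X X"
    and comp_hom: "f \<in> hom C X Y \<Longrightarrow> g \<in> hom C Y Z \<Longrightarrow> g \<cdot> f \<in> hom C X Z"
    and comp_id: "f \<in> hom C X Y \<Longrightarrow> f \<cdot> Ident C X = f"
    and id_comp: "f \<in> hom C X Y \<Longrightarrow> Ident C Y \<cdot> f = f"
    and comp_assoc: "f \<in> hom C W X \<Longrightarrow> g \<in> hom C X Y \<Longrightarrow> h \<in> hom C Y Z
      \<Longrightarrow> (h \<cdot> g) \<cdot> f = h \<cdot> (g \<cdot> f)"

definition monomorphism ::
    "('o, 'm, 'z) category_data_scheme \<Rightarrow> 'o \<Rightarrow> 'o \<Rightarrow> 'm \<Rightarrow> bool" where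
  "monomorphism C Y X m \<longleftrightarrow> m \<in> hom C Y X \<and>
     (\<forall>Z. \<forall>g \<in> hom C Z Y. \<forall>h \<in> hom C Z Y. m \<cdot>\<^bsub>C\<^esub> g = m \<cdot>\<^bsub>C\<^esub> h \<longrightarrow> g = h)"

definition subobject :: "('o, 'm, 'z) category_data_scheme \<Rightarrow> 'o \<Rightarrow> 'o \<Rightarrow> bool" where
  "subobject C Y X \<longleftrightarrow> (\<exists>m. monomorphism C Y X m)"

text \<open>
  Indices modulo \<open>n\<close> are represented by \<open>0, \<dots>, n - 1\<close>, so that \<open>0\<close> stands for the index \<open>n\<close>;
  the successor of \<open>i\<close> is \<open>Suc i mod n\<close>. Only the values of a family at indices below \<open>n\<close> matter.
\<close>

definition cyclic_sequence ::
    "('o, 'm, 'z) category_data_scheme \<Rightarrow> nat \<Rightarrow> (nat \<Rightarrow> 'o) \<Rightarrow> (nat \<Rightarrow> 'm) \<Rightarrow> bool" where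
  "cyclic_sequence C n X f \<longleftrightarrow> (\<forall>i<n. f i \<in> hom C (X i) (X (Suc i mod n)))"

text \<open>
  \<open>cyclic_comp C n f i k\<close> is the composite \<open>f (i + k) \<circ> \<dots> \<circ> f (i + 1) \<circ> f i\<close> of \<open>k + 1\<close>
  (not \<open>k\<close>) morphisms, with indices modulo \<open>n\<close>.
\<close>

primrec cyclic_comp ::
    "('o, 'm, 'z) category_data_scheme \<Rightarrow> nat \<Rightarrow> (nat \<Rightarrow> 'm) \<Rightarrow> nat \<Rightarrow> nat \<Rightarrow> 'm" where
  "cyclic_comp C n f i 0 = f (i mod n)"
| "cyclic_comp C n f i (Suc k) = f ((i + Suc k) mod n) \<cdot>\<^bsub>C\<^esub> cyclic_comp C n f i k"

definition regular_cocycle ::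
    "('o, 'm, 'z) category_data_scheme \<Rightarrow> nat \<Rightarrow> (nat \<Rightarrow> 'o) \<Rightarrow> (nat \<Rightarrow> 'm) \<Rightarrow> bool" where
  "regular_cocycle C n X f \<longleftrightarrow>
     cyclic_sequence C n X f \<and> (\<forall>i<n. cyclic_comp C n f i n = f i)"

end

theory Submission
  imports Defs
begin

text \<open>In a composite of consecutive \<open>f i\<close>, every inner \<open>\<iota>\<close> is
  followed by the \<open>\<pi>\<close> of the same index, and the two cancel because
  \<open>\<pi> i\<close> retracts \<open>\<iota> i\<close>. So any such composite is the
  corresponding composite of the \<open>f' i\<close>, framed by one \<open>\<pi>\<close> and one
  \<open>\<iota>\<close> (\<open>cyclic_comp_conjugate\<close>, by iterating
  \<open>comp_conjugate\<close>). For n + 1 factors the inner composite is \<open>f' i\<close> after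
  a full turn, and the full turn is the identity; what remains is \<open>f' i\<close> in its frame,
  that is, \<open>f i\<close>.\<close>

lemma (in category) cyclic_comp_hom:
  assumes "n \<ge> 1" and "cyclic_sequence C n X f"
  shows "cyclic_comp C n f i k \<in> hom C (X (i mod n)) (X (Suc (i + k) mod n))"
proof (induction k)
  case 0
  have "f (i mod n) \<in> hom C (X (i mod n)) (X (Suc (i mod n) mod n))"
    using assms by (simp add: cyclic_sequence_def)
  then show ?case by (simp add: mod_Suc_eq)
next
  case (Suc k)
  have "f (Suc (i + k) mod n) \<in> hom C (X (Suc (i + k) mod n)) (X (Suc (Suc (i + k) mod n) mod n))"
    using assms by (simp add: cyclic_sequence_def)
  with Suc show ?case by (simp add: mod_Suc_eq comp_hom)
qed

text \<open>One cancellation: reassociating brings \<open>p'\<close> next to \<open>j\<close>, where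
  the retraction equation removes both.\<close>

lemma (in category) comp_conjugate:
  assumes p: "p \<in> hom C X Y" and c: "c \<in> hom C Y Y'" and j: "j \<in> hom C Y' X'"
    and p': "p' \<in> hom C X' Y'" and g: "g \<in> hom C Y' Y''" and j'': "j'' \<in> hom C Y'' X''"
    and retract: "p' \<cdot> j = Ident C Y'"
  shows "(j'' \<cdot> g \<cdot> p') \<cdot> (j \<cdot> c \<cdot> p) = j'' \<cdot> (g \<cdot> c) \<cdot> p"
proof -
  have jg: "j'' \<cdot> g \<in> hom C Y' X''" using g j'' by (rule comp_hom)
  have jc: "j \<cdot> c \<in> hom C Y X'" using c j by (rule comp_hom)
  have "(j'' \<cdot> g \<cdot> p') \<cdot> (j \<cdot> c \<cdot> p) = ((j'' \<cdot> g \<cdot> p') \<cdot> (j \<cdot> c)) \<cdot> p"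
    using comp_assoc[OF p jc comp_hom[OF p' jg]] by simp
  also have "(j'' \<cdot> g \<cdot> p') \<cdot> (j \<cdot> c) = (j'' \<cdot> g) \<cdot> (p' \<cdot> (j \<cdot> c))"
    using comp_assoc[OF jc p' jg] .
  also have "p' \<cdot> (j \<cdot> c) = c"
    using comp_assoc[OF c j p'] id_comp[OF c] retract by simp
  also have "(j'' \<cdot> g) \<cdot> c = j'' \<cdot> (g \<cdot> c)"
    using comp_assoc[OF c g j''] .
  finally show ?thesis .
qed

text \<open>Telescoping by induction on the length \<open>k\<close>: each new factor
  \<open>f\<close> meets the outer \<open>\<iota>\<close> of the previous composite with its own
  \<open>\<pi>\<close>.\<close>

lemma (in category) cyclic_comp_conjugate:
  assumes n: "n \<ge> 1" and f': "cyclic_sequence C n Y f'"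
    and \<pi>: "\<And>i. i < n \<Longrightarrow> \<pi> i \<in> hom C (X i) (Y i)"
    and \<iota>: "\<And>i. i < n \<Longrightarrow> \<iota> i \<in> hom C (Y i) (X i)"
    and retract: "\<And>i. i < n \<Longrightarrow> \<pi> i \<cdot> \<iota> i = Ident C (Y i)"
    and f: "\<And>i. i < n \<Longrightarrow> f i = \<iota> (Suc i mod n) \<cdot> f' i \<cdot> \<pi> i"
  shows "cyclic_comp C n f i k = \<iota> (Suc (i + k) mod n) \<cdot> cyclic_comp C n f' i k \<cdot> \<pi> (i mod n)"
proof (induction k)
  case 0
  show ?case using n f[of "i mod n"] by (simp add: mod_Suc_eq)
next
  case (Suc k)
  let ?j = "Suc (i + k) mod n"
  have lt: "?j < n" "i mod n < n" "Suc ?j mod n < n" using n by simp_all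
  have g: "f' ?j \<in> hom C (Y ?j) (Y (Suc ?j mod n))"
    using f' lt by (simp add: cyclic_sequence_def)
  \<comment> \<open>The cancelled pair sits at index \<open>?j\<close>, where the composite so far
    ends and the new factor \<open>f ?j\<close> begins.\<close>
  show ?case
    using comp_conjugate[OF \<pi>[OF lt(2)] cyclic_comp_hom[OF n f', of i k] \<iota>[OF lt(1)] \<pi>[OF lt(1)]
        g \<iota>[OF lt(3)] retract[OF lt(1)]] f[OF lt(1)] Suc
    by (simp add: mod_Suc_eq)
qed

theorem theorem15:
  fixes C :: "('o, 'm, 'z) category_data_scheme"
    and n :: nat
    and X Y :: "nat \<Rightarrow> 'o"
    and f f' \<pi> \<iota> :: "nat \<Rightarrow> 'm"
  assumes "n \<ge> 1"
    and "category C"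
    and "cyclic_sequence C n X f"
    and "cyclic_sequence C n Y f'"
    and "\<And>i. i < n \<Longrightarrow> subobject C (Y i) (X i)"
    and "\<And>i. i < n \<Longrightarrow> \<pi> i \<in> hom C (X i) (Y i)"
    and "\<And>i. i < n \<Longrightarrow> \<iota> i \<in> hom C (Y i) (X i)"
    and "\<And>i. i < n \<Longrightarrow> \<pi> i \<cdot>\<^bsub>C\<^esub> \<iota> i = Ident C (Y i)"
    and "\<And>i. i < n \<Longrightarrow> cyclic_comp C n f' i (n - 1) = Ident C (Y i)"
    and "\<And>i. i < n \<Longrightarrow> f i = \<iota> (Suc i mod n) \<cdot>\<^bsub>C\<^esub> f' i \<cdot>\<^bsub>C\<^esub> \<pi> i"
  shows "regular_cocycle C n X f"
proof -
  interpret category C by fact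
  have "cyclic_comp C n f i n = f i" if i: "i < n" for i
  proof -
    obtain m where m: "n = Suc m" using \<open>n \<ge> 1\<close> by (cases n) auto
    have f'i: "f' i \<in> hom C (Y i) (Y (Suc i mod n))"
      using assms(4) i by (simp add: cyclic_sequence_def)
    \<comment> \<open>Parameter \<open>n\<close> means n + 1 factors. Splitting off the last one,
      whose index reduces to \<open>i\<close>, leaves the n factors of a full turn.\<close>
    have "cyclic_comp C n f' i n = f' ((i + n) mod n) \<cdot>\<^bsub>C\<^esub> cyclic_comp C n f' i (n - 1)"
      by (simp add: m)
    also have "\<dots> = f' i"
      using assms(9)[OF i] comp_id[OF f'i] i by simp
    finally have "cyclic_comp C n f' i n = f' i" .
    \<comment> \<open>This identifies the outer \<open>\<iota>\<close> of the long composite with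
      the one in the factorization of \<open>f i\<close>.\<close>
    moreover have "Suc (i + n) mod n = Suc i mod n"
      using mod_add_self2[of "Suc i" n] by simp
    ultimately show ?thesis
      using cyclic_comp_conjugate[where X = X and f = f and k = n and i = i, OF assms(1,4,6,7,8,10)]
        assms(10)[OF i] i by simp
  qed
  then show ?thesis
    using assms(3) by (simp add: regular_cocycle_def)
qed

end
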